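(* Let $n \in \mathbb{N}$. Then $$N(1,3,9,9;\,8n+22) = 40\, t'(1,3,9,9;\,n).$$
   Context: $\mathbb{N}$ denotes the set of positive integers. For $a,b,c,d\in\mathbb{N}$ and an integer $m\ge 0$, $N(a,b,c,d;m)$ is the number of $(x,y,z,w)\in\mathbb{Z}^4$ with $m = ax^2+by^2+cz^2+dw^2$, and $t'(a,b,c,d;m)$ is the number of $(x,y,z,w)\in\mathbb{N}^4$ with $m = a\frac{x(x-1)}{2}+b\frac{y(y-1)}{2}+c\frac{z(z-1)}{2}+d\frac{w(w-1)}{2}$. *)

theory Defs
  imports Main
begin

text \<open>For positive coefficients both solution sets below are finite, so \<open>card\<close> is the
  genuine number of solutions.\<close>

definition quad_rep_count :: "nat \<Rightarrow> nat \<Rightarrow> nat \<Rightarrow> nat \<Rightarrow> nat \<Rightarrow> nat" where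
  "quad_rep_count a b c d m =
     card {(x :: int, y :: int, z :: int, w :: int).
             int m = int a * x\<^sup>2 + int b * y\<^sup>2 + int c * z\<^sup>2 + int d * w\<^sup>2}"

text \<open>The variables range over the positive integers, so the subtraction on \<open>nat\<close> does not
  truncate; \<open>x * (x - 1)\<close> is even, so \<open>div\<close> is exact.\<close>

definition tri_rep_count :: "nat \<Rightarrow> nat \<Rightarrow> nat \<Rightarrow> nat \<Rightarrow> nat \<Rightarrow> nat" where
  "tri_rep_count a b c d m =
     card {(x :: nat, y :: nat, z :: nat, w :: nat).
             x \<ge> 1 \<and> y \<ge> 1 \<and> z \<ge> 1 \<and> w \<ge> 1 \<and>
             m = a * (x * (x - 1) div 2) + b * (y * (y - 1) div 2)
               + c * (z * (z - 1) div 2) + d * (w * (w - 1) div 2)}"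

end

theory Submission
  imports Defs
begin

text \<open>
  All-odd solutions of \<open>x\<^sup>2 + 3y\<^sup>2 + 9z\<^sup>2 + 9w\<^sup>2 = 8n + 22\<close> correspond, up to the 16 choices of
  signs, to the solutions counted by \<open>t'\<close>. Modulo 8, every other solution has \<open>y\<close> and exactly one
  of \<open>x, z, w\<close> even, say \<open>e\<close>, with \<open>e/2 + y/2\<close> odd. On the binary form \<open>x\<^sup>2 + 3y\<^sup>2\<close>, a rotation by 60
  degrees matches such even pairs with the odd pairs satisfying \<open>4 dvd x - y\<close>, which are half
  of all odd pairs. Applied to \<open>x\<^sup>2 + 3y\<^sup>2\<close>, \<open>3(y\<^sup>2 + 3z\<^sup>2)\<close> and \<open>3(y\<^sup>2 + 3w\<^sup>2)\<close>, this makes each of the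
  three remaining families half as large as the all-odd one, and \<open>16 (1 + 3/2) = 40\<close>.
\<close>

text \<open>The map sends \<open>u - v * sqrt (-3)\<close> to its product with
  \<open>1 + sqrt (-3)\<close>, which has norm 4 and is twice a sixth root of unity. The inverse
  comes from \<open>x - y = 4 * v\<close>. The predicate \<open>P\<close> and the parameter
  \<open>p\<close> carry the other two variables along, so that the result serves several pairs of
  variables.\<close>

lemma bij_betw_hex_rotation:
  fixes P :: "int \<Rightarrow> 'a \<Rightarrow> bool"
  shows "bij_betw (\<lambda>(u, v, p). (u + 3 * v, u - v, p))
    {(u, v, p). odd (u + v) \<and> P (4 * u\<^sup>2 + 12 * v\<^sup>2) p}
    {(x, y, p). odd x \<and> odd y \<and> 4 dvd x - y \<and> P (x\<^sup>2 + 3 * y\<^sup>2) p}"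
    (is "bij_betw ?f ?U ?A")
proof -
  let ?g = "\<lambda>(x, y, p). (y + (x - y) div 4, (x - y) div 4, p)"
  have norm: "(u + 3 * v)\<^sup>2 + 3 * (u - v)\<^sup>2 = 4 * u\<^sup>2 + 12 * v\<^sup>2" for u v :: int
    by (simp add: power2_eq_square algebra_simps)
  show ?thesis
  proof (rule bij_betw_byWitness[where f' = ?g])
    show "\<forall>a\<in>?U. ?g (?f a) = a" by auto
    show "\<forall>a\<in>?A. ?f (?g a) = a" by auto
    show "?f ` ?U \<subseteq> ?A" by (auto simp: norm)
    show "?g ` ?A \<subseteq> ?U"
    proof (rule image_subsetI)
      fix a assume "a \<in> ?A"
      then obtain x y p where a: "a = (x, y, p)"
        and xy: "odd y" "4 dvd x - y" "P (x\<^sup>2 + 3 * y\<^sup>2) p"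
        by blast
      from \<open>4 dvd x - y\<close> obtain v where "x - y = 4 * v" by (elim dvdE)
      then have x: "x = (y + v) + 3 * v" by simp
      show "?g a \<in> ?U"
        using xy norm[of "y + v" v] unfolding a x by simp
    qed
  qed
qed

lemma bij_betw_double_pair:
  fixes P :: "int \<Rightarrow> 'a \<Rightarrow> bool"
  shows "bij_betw (\<lambda>(u, v, p). (2 * u, 2 * v, p))
    {(u, v, p). odd (u + v) \<and> P (4 * u\<^sup>2 + 12 * v\<^sup>2) p}
    {(x, y, p). even x \<and> even y \<and> odd (x div 2 + y div 2) \<and> P (x\<^sup>2 + 3 * y\<^sup>2) p}"
  by (rule bij_betw_byWitness[where f' = "\<lambda>(x, y, p). (x div 2, y div 2, p)"])
    (auto simp: power_mult_distrib elim!: evenE)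

text \<open>Changing the sign of \<open>y\<close> exchanges the odd pairs with
  \<open>4 dvd x - y\<close> and those with \<open>4 dvd x + y\<close>, so each class is half of all
  odd pairs.\<close>

lemma card_odd_pairs_eq:
  fixes P :: "int \<Rightarrow> 'a \<Rightarrow> bool"
  assumes "finite {(x, y, p). odd x \<and> odd y \<and> P (x\<^sup>2 + 3 * y\<^sup>2) p}" (is "finite ?O")
  shows "card {(x, y, p). odd x \<and> odd y \<and> P (x\<^sup>2 + 3 * y\<^sup>2) p} =
    2 * card {(x, y, p). even x \<and> even y \<and> odd (x div 2 + y div 2) \<and> P (x\<^sup>2 + 3 * y\<^sup>2) p}"
    (is "_ = 2 * card ?E")
proof -
  let ?A = "{(x, y, p). odd x \<and> odd y \<and> 4 dvd x - y \<and> P (x\<^sup>2 + 3 * y\<^sup>2) p}"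
  let ?B = "{(x, y, p). odd x \<and> odd y \<and> 4 dvd x + y \<and> P (x\<^sup>2 + 3 * y\<^sup>2) p}"
  \<comment> \<open>Both \<open>x - y\<close> and \<open>x + y\<close> are even, and their sum
    \<open>2 * x\<close> is 2 modulo 4, so exactly one of them is divisible by 4.\<close>
  have split: "4 dvd x - y \<longleftrightarrow> \<not> 4 dvd x + y" if "odd x" "odd y" for x y :: int
    using that by presburger
  have "?O = ?A \<union> ?B" "?A \<inter> ?B = {}"
    using split by auto
  moreover have "finite ?A" "finite ?B"
    by (rule finite_subset[OF _ assms]; auto)+
  ultimately have "card ?O = card ?A + card ?B"
    by (simp add: card_Un_disjoint)
  moreover have "bij_betw (\<lambda>(x, y, p). (x, - y, p)) ?A ?B"
    by (rule bij_betw_byWitness[where f' = "\<lambda>(x, y, p). (x, - y, p)"]) auto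
  then have "card ?A = card ?B"
    by (rule bij_betw_same_card)
  \<comment> \<open>Both sets are images of the same pairs \<open>(u, v)\<close> with
    \<open>u + v\<close> odd: one under the rotation, the other under doubling.\<close>
  moreover have "card ?A = card ?E"
    by (rule trans[OF bij_betw_same_card[OF bij_betw_hex_rotation, symmetric]
          bij_betw_same_card[OF bij_betw_double_pair]])
  ultimately show ?thesis by simp
qed

abbreviation quad_sols :: "int \<Rightarrow> (int \<times> int \<times> int \<times> int) set" where
  "quad_sols M \<equiv> {(x, y, z, w). x\<^sup>2 + 3 * y\<^sup>2 + 9 * z\<^sup>2 + 9 * w\<^sup>2 = M}"

abbreviation odd_quad_sols :: "int \<Rightarrow> (int \<times> int \<times> int \<times> int) set" where
  "odd_quad_sols M \<equiv> {(x, y, z, w). odd x \<and> odd y \<and> odd z \<and> odd w \<and>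
     x\<^sup>2 + 3 * y\<^sup>2 + 9 * z\<^sup>2 + 9 * w\<^sup>2 = M}"

lemma finite_quad_sols: "finite (quad_sols M)"
proof (rule finite_subset)
  have le: "t \<in> {- M..M}" if "t\<^sup>2 \<le> M" for t :: int
  proof -
    have "\<bar>t\<bar> \<le> t\<^sup>2"
      using mult_left_mono[of 1 "\<bar>t\<bar>" "\<bar>t\<bar>"] by (cases "t = 0") (auto simp: power2_eq_square)
    then show ?thesis using that by auto
  qed
  show "quad_sols M \<subseteq> {- M..M} \<times> {- M..M} \<times> {- M..M} \<times> {- M..M}"
  proof (rule subsetI)
    fix t assume "t \<in> quad_sols M"
    then obtain x y z w where t: "t = (x, y, z, w)" and "x\<^sup>2 + 3 * y\<^sup>2 + 9 * z\<^sup>2 + 9 * w\<^sup>2 = M"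
      by blast
    moreover have "x\<^sup>2 \<ge> 0" "y\<^sup>2 \<ge> 0" "z\<^sup>2 \<ge> 0" "w\<^sup>2 \<ge> 0" by auto
    ultimately have "x\<^sup>2 \<le> M" "y\<^sup>2 \<le> M" "z\<^sup>2 \<le> M" "w\<^sup>2 \<le> M" by linarith+
    then show "t \<in> {- M..M} \<times> {- M..M} \<times> {- M..M} \<times> {- M..M}"
      unfolding t using le by blast
  qed
qed simp

lemma square_mod_8:
  fixes x :: int
  shows "x\<^sup>2 mod 8 = (if odd x then 1 else if even (x div 2) then 0 else 4)"
proof -
  define q where "q = x div 4"
  have "x = 4 * q \<or> x = 4 * q + 1 \<or> x = 4 * q + 2 \<or> x = 4 * q + 3"
    unfolding q_def by presburger
  moreover have "(4 * q)\<^sup>2 = 8 * (2 * q\<^sup>2)" "(4 * q + 1)\<^sup>2 = 8 * (2 * q\<^sup>2 + q) + 1"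
    "(4 * q + 2)\<^sup>2 = 8 * (2 * q\<^sup>2 + 2 * q) + 4" "(4 * q + 3)\<^sup>2 = 8 * (2 * q\<^sup>2 + 3 * q + 1) + 1"
    by (simp_all add: power2_eq_square algebra_simps)
  then have "(4 * q)\<^sup>2 mod 8 = 0" "(4 * q + 1)\<^sup>2 mod 8 = 1" "(4 * q + 2)\<^sup>2 mod 8 = 4" "(4 * q + 3)\<^sup>2 mod 8 = 1"
    by presburger+
  ultimately show ?thesis
    by (elim disjE) simp_all
qed

text \<open>Modulo 8 the coefficients are 1, 3, 1, 1. An even sum needs an even number of odd
  variables. With none odd, or with \<open>y\<close> and just one other odd, the sum is 0 modulo 4.
  If \<open>y\<close> and one further variable are the even ones, the odd squares give 2, so exactly
  one of the two even squares must be 4 modulo 8.\<close>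

lemma quad_sols_parity:
  fixes x y z w :: int
  assumes "(x\<^sup>2 + 3 * y\<^sup>2 + 9 * z\<^sup>2 + 9 * w\<^sup>2) mod 8 = 6"
  shows "odd x \<and> odd y \<and> odd z \<and> odd w
    \<or> even x \<and> even y \<and> odd (x div 2 + y div 2) \<and> odd z \<and> odd w
    \<or> even y \<and> even z \<and> odd (y div 2 + z div 2) \<and> odd x \<and> odd w
    \<or> even y \<and> even w \<and> odd (y div 2 + w div 2) \<and> odd x \<and> odd z"
proof -
  let ?r = "\<lambda>p p'. if \<not> p then 1 else if p' then 0 else 4 :: int"
  \<comment> \<open>Here \<open>p\<close> stands for a variable being even and \<open>p'\<close> for
    its half being even, which leaves a finite Boolean check.\<close>
  have residues: "\<not> p \<and> \<not> q \<and> \<not> r \<and> \<not> s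
      \<or> p \<and> q \<and> p' \<noteq> q' \<and> \<not> r \<and> \<not> s
      \<or> q \<and> r \<and> q' \<noteq> r' \<and> \<not> p \<and> \<not> s
      \<or> q \<and> s \<and> q' \<noteq> s' \<and> \<not> p \<and> \<not> r"
    if "(?r p p' + 3 * ?r q q' + 9 * ?r r r' + 9 * ?r s s') mod 8 = 6" for p p' q q' r r' s s'
    using that
    by (cases p; cases q; cases r; cases s; cases p'; cases q'; cases r'; cases s'; simp)
  have "(x\<^sup>2 mod 8 + 3 * (y\<^sup>2 mod 8) + 9 * (z\<^sup>2 mod 8) + 9 * (w\<^sup>2 mod 8)) mod 8
      = (x\<^sup>2 + 3 * y\<^sup>2 + 9 * z\<^sup>2 + 9 * w\<^sup>2) mod 8"
    by (intro mod_add_cong mod_mult_cong) simp_all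
  also note assms
  finally show ?thesis
    unfolding square_mod_8 even_add by (rule residues)
qed

lemma card_quad_sols:
  assumes "M mod 8 = 6"
  shows "2 * card (quad_sols M) = 5 * card (odd_quad_sols M)"
proof -
  let ?X = "{(x, y, z, w). even x \<and> even y \<and> odd (x div 2 + y div 2) \<and> odd z \<and> odd w \<and>
    x\<^sup>2 + 3 * y\<^sup>2 + 9 * z\<^sup>2 + 9 * w\<^sup>2 = M}"
  let ?Z = "{(x, y, z, w). even y \<and> even z \<and> odd (y div 2 + z div 2) \<and> odd x \<and> odd w \<and>
    x\<^sup>2 + 3 * y\<^sup>2 + 9 * z\<^sup>2 + 9 * w\<^sup>2 = M}"
  let ?W = "{(x, y, z, w). even y \<and> even w \<and> odd (y div 2 + w div 2) \<and> odd x \<and> odd z \<and>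
    x\<^sup>2 + 3 * y\<^sup>2 + 9 * z\<^sup>2 + 9 * w\<^sup>2 = M}"
  let ?O = "odd_quad_sols M"
  have fin: "finite ?O" "finite ?X" "finite ?Z" "finite ?W"
    by (rule finite_subset[OF _ finite_quad_sols[of M]]; auto)+
  have "quad_sols M = ?O \<union> ?X \<union> ?Z \<union> ?W"
  proof (intro equalityI subsetI)
    fix t assume "t \<in> quad_sols M"
    then obtain x y z w where t: "t = (x, y, z, w)" and M: "x\<^sup>2 + 3 * y\<^sup>2 + 9 * z\<^sup>2 + 9 * w\<^sup>2 = M"
      by blast
    show "t \<in> ?O \<union> ?X \<union> ?Z \<union> ?W"
      using quad_sols_parity[OF assms[folded M]] M unfolding t by simp
  qed auto
  moreover have "?O \<inter> ?X = {}" "(?O \<union> ?X) \<inter> ?Z = {}" "(?O \<union> ?X \<union> ?Z) \<inter> ?W = {}"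
    by auto
  ultimately have sum: "card (quad_sols M) = card ?O + card ?X + card ?Z + card ?W"
    using fin by (simp add: card_Un_disjoint)
  have X: "card ?O = 2 * card ?X"
    using card_odd_pairs_eq[of "\<lambda>k (z, w). odd z \<and> odd w \<and> k + 9 * z\<^sup>2 + 9 * w\<^sup>2 = M"] fin(1)
    by simp
  \<comment> \<open>Since \<open>3 * y\<^sup>2 + 9 * z\<^sup>2 = 3 * (y\<^sup>2 + 3 *
    z\<^sup>2)\<close>, the norm \<open>k\<close> of the pair \<open>(y, z)\<close> enters with
    factor 3; the coordinates are permuted to put this pair first.\<close>
  let ?P = "\<lambda>k (x, w). odd x \<and> odd w \<and> x\<^sup>2 + 3 * k + 9 * w\<^sup>2 = M"
  let ?O' = "{(y, z, p). odd y \<and> odd z \<and> ?P (y\<^sup>2 + 3 * z\<^sup>2) p}"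
  let ?Z' = "{(y, z, p). even y \<and> even z \<and> odd (y div 2 + z div 2) \<and> ?P (y\<^sup>2 + 3 * z\<^sup>2) p}"
  have O': "bij_betw (\<lambda>(x, y, z, w). (y, z, x, w)) ?O ?O'"
    by (rule bij_betw_byWitness[where f' = "\<lambda>(y, z, x, w). (x, y, z, w)"]) (auto simp: algebra_simps)
  have Z': "bij_betw (\<lambda>(x, y, z, w). (y, z, x, w)) ?Z ?Z'"
    by (rule bij_betw_byWitness[where f' = "\<lambda>(y, z, x, w). (x, y, z, w)"]) (auto simp: algebra_simps)
  \<comment> \<open>\<open>z\<close> and \<open>w\<close> share the coefficient 9, so swapping them
    reduces the last family to the previous one.\<close>
  have W: "bij_betw (\<lambda>(x, y, z, w). (x, y, w, z)) ?Z ?W"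
    by (rule bij_betw_byWitness[where f' = "\<lambda>(x, y, z, w). (x, y, w, z)"]) auto
  have "finite ?O'"
    using bij_betw_finite[OF O'] fin(1) by simp
  then have "card ?O' = 2 * card ?Z'"
    by (rule card_odd_pairs_eq)
  then have Z: "card ?O = 2 * card ?Z"
    using bij_betw_same_card[OF O'] bij_betw_same_card[OF Z'] by simp
  show ?thesis
    using sum X Z bij_betw_same_card[OF W] by simp
qed

lemma square_odd_eq_triangular:
  assumes "x \<ge> 1"
  shows "(2 * int x - 1)\<^sup>2 = 8 * int (x * (x - 1) div 2) + 1"
proof -
  have "2 * (x * (x - 1) div 2) = x * (x - 1)" by (rule dvd_mult_div_cancel) (cases x; simp)
  then have "2 * int (x * (x - 1) div 2) = int x * (int x - 1)"
    using assms by (metis of_nat_mult of_nat_numeral of_nat_diff of_nat_1)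
  then show ?thesis by (simp add: power2_eq_square algebra_simps)
qed

text \<open>Every odd integer is uniquely \<open>e * (2 * k - 1)\<close> with a sign
  \<open>e\<close> and \<open>k \<ge> 1\<close>, and its square is 8 times a triangular number plus
  1. The four ones contribute 1 + 3 + 9 + 9 = 22, and the signs contribute the factor 16.\<close>

lemma card_odd_quad_sols:
  "card (odd_quad_sols (int (8 * n + 22))) = 16 * tri_rep_count 1 3 9 9 n"
proof -
  define tri where "tri x = x * (x - 1) div 2" for x :: nat
  define s where "s e x = e * (2 * int x - 1)" for e :: int and x :: nat
  \<comment> \<open>This recovers \<open>k\<close> from
    \<open>\<bar>x\<bar> = 2 * k - 1\<close>.\<close>
  define h where "h x = nat ((\<bar>x\<bar> + 1) div 2)" for x :: int
  let ?T = "{(x, y, z, w). x \<ge> 1 \<and> y \<ge> 1 \<and> z \<ge> 1 \<and> w \<ge> 1 \<and>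
    n = 1 * tri x + 3 * tri y + 9 * tri z + 9 * tri w}"
  let ?O = "odd_quad_sols (int (8 * n + 22))"
  define S where "S = {1, -1 :: int}"
  let ?f = "\<lambda>((x, y, z, w), (a, b, c, d)). (s a x, s b y, s c z, s d w)"
  let ?g = "\<lambda>(x, y, z, w). ((h x, h y, h z, h w), (sgn x, sgn y, sgn z, sgn w))"
  have hs: "h (s e x) = x" "sgn (s e x) = e" "odd (s e x)" "(s e x)\<^sup>2 = 8 * int (tri x) + 1"
    if "x \<ge> 1" "e \<in> S" for e x
    using that square_odd_eq_triangular[OF \<open>x \<ge> 1\<close>]
    by (auto simp: S_def h_def s_def tri_def sgn_if power_mult_distrib)
  have sh: "s (sgn x) (h x) = x" "sgn x \<in> S" "h x \<ge> 1" if "odd x" for x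
  proof -
    have "x \<noteq> 0" using that by auto
    then show "sgn x \<in> S" by (simp add: S_def sgn_if)
    have "2 * ((\<bar>x\<bar> + 1) div 2) = \<bar>x\<bar> + 1"
      by (rule dvd_mult_div_cancel) (use that in simp)
    then have "2 * int (h x) = \<bar>x\<bar> + 1" by (simp add: h_def)
    then show "s (sgn x) (h x) = x" "h x \<ge> 1"
      by (simp_all add: s_def sgn_mult_abs)
  qed
  have sq: "x\<^sup>2 = 8 * int (tri (h x)) + 1" if "odd x" for x
    using hs(4)[OF sh(3) sh(2), OF that that] unfolding sh(1)[OF that] .
  have "bij_betw ?g ?O (?T \<times> (S \<times> S \<times> S \<times> S))"
  proof (rule bij_betw_byWitness[where f' = ?f])
    show "\<forall>a\<in>?O. ?f (?g a) = a"
      by (clarsimp simp: sh(1))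
    show "?g ` ?O \<subseteq> ?T \<times> (S \<times> S \<times> S \<times> S)"
    proof (rule image_subsetI)
      fix t assume "t \<in> ?O"
      then obtain x y z w where t: "t = (x, y, z, w)"
        and odd: "odd x" "odd y" "odd z" "odd w"
        and "x\<^sup>2 + 3 * y\<^sup>2 + 9 * z\<^sup>2 + 9 * w\<^sup>2 = int (8 * n + 22)"
        by blast
      then have "n = 1 * tri (h x) + 3 * tri (h y) + 9 * tri (h z) + 9 * tri (h w)"
        using odd[THEN sq] by linarith
      then show "?g t \<in> ?T \<times> (S \<times> S \<times> S \<times> S)"
        unfolding t using odd[THEN sh(2)] odd[THEN sh(3)] by simp
    qed
    show "\<forall>a\<in>?T \<times> (S \<times> S \<times> S \<times> S). ?g (?f a) = a"
      by (clarsimp simp: hs(1,2))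
    show "?f ` (?T \<times> (S \<times> S \<times> S \<times> S)) \<subseteq> ?O"
    proof (rule image_subsetI)
      fix t assume "t \<in> ?T \<times> (S \<times> S \<times> S \<times> S)"
      then obtain x y z w a b c d where t: "t = ((x, y, z, w), (a, b, c, d))"
        and ge: "x \<ge> 1" "y \<ge> 1" "z \<ge> 1" "w \<ge> 1"
        and S: "a \<in> S" "b \<in> S" "c \<in> S" "d \<in> S"
        and n: "n = 1 * tri x + 3 * tri y + 9 * tri z + 9 * tri w"
        by blast
      have "(s a x)\<^sup>2 + 3 * (s b y)\<^sup>2 + 9 * (s c z)\<^sup>2 + 9 * (s d w)\<^sup>2 = int (8 * n + 22)"
        unfolding hs(4)[OF ge(1) S(1)] hs(4)[OF ge(2) S(2)] hs(4)[OF ge(3) S(3)] hs(4)[OF ge(4) S(4)]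
        using n by simp
      then show "?f t \<in> ?O"
        unfolding t using ge S by (simp add: hs(3))
    qed
  qed
  then have "card ?O = card (?T \<times> (S \<times> S \<times> S \<times> S))"
    by (rule bij_betw_same_card)
  also have "\<dots> = card ?T * 16"
    by (simp only: card_cartesian_product) (simp add: S_def)
  finally show ?thesis
    unfolding tri_rep_count_def tri_def by simp
qed

theorem theorem2p1:
  fixes n :: nat
  assumes "n \<ge> 1"
  shows "quad_rep_count 1 3 9 9 (8 * n + 22) = 40 * tri_rep_count 1 3 9 9 n"
proof -
  have "quad_rep_count 1 3 9 9 (8 * n + 22) = card (quad_sols (int (8 * n + 22)))"
    unfolding quad_rep_count_def by (rule arg_cong[where f = card]) auto
  moreover have "int (8 * n + 22) mod 8 = 6"
    by presburger
  \<comment> \<open>Twice the left-hand count is 5 * 16 times the triangular count.\<close>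
  ultimately show ?thesis
    using card_quad_sols[of "int (8 * n + 22)"] card_odd_quad_sols[of n] by linarith
qed

end
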